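(* Let $T$ be a real symmetric $2\times2$ matrix and $Q:=\{(x,y)\in\mathbb{R}^2\mid (x,y)T(x,y)^t=1\}$. Let $a,b,c\in Q$ be pairwise linearly independent. a) For the area $\Delta$ of the triangle with vertices $o,a,b$ it holds $\delta^2(a,b;c)=1-4\Delta^2\det T$. b) In the elliptic case ($|\delta(a,b;c)|<1$) or bounded hyperbolic case ($\delta(a,b;c)>1$) the area of the sector region of $(Q,o;a,b)$ equals $\angle(a,b;c)/(2\sqrt{|\det T|})$. c) Write $(x,y)T(x,y)^t=\alpha x^2+\beta xy+\gamma y^2$ and $a=(\kappa,\lambda)$, $b=(\mu,\nu)$. The sector region of $(Q,o;a,b)$ is bounded if and only if $$\delta:=\alpha\kappa\mu+\beta(\kappa\nu+\lambda\mu)/2+\gamma\lambda\nu>-1.$$ Then its area equals $$\frac{\arccos(\delta)}{\sqrt{4\alpha\gamma-\beta^2}}\quad\text{or}\quad\frac{\operatorname{arcosh}(\delta)}{\sqrt{\beta^2-4\alpha\gamma}}$$ in the elliptic case ($|\delta|<1$) or the bounded hyperbolic case ($\delta>1$), respectively. d) If $c$ lies between $a$ and $b$, i.e. $c=xa+yb$ with $x,y>0$, then, provided these angles are defined, $$\angle(a,c;b)+\angle(c,b;a)=\angle(a,b;c).$$ e) In the elliptic case ($|\delta(a,b;c)|<1$), if $-c$ lies between $a$ and $b$, i.e. $-c=xa+yb$ with $x,y>0$, then $$\angle(a,b;c)+\angle(b,c;a)+\angle(c,a;b)=2\pi.$$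
   Context: Let $o$ be the origin of $\mathbb{R}^2$. A quadric of $\mathbb{R}^2$ is a non-empty set $\{x\mid q(x)+l(x)+\gamma_0=0\}$ with a quadratic form $q$, a linear form $l$ and a scalar $\gamma_0$; a point $p$ is an external centre of it if $p$ does not lie on it and $2p-x$ lies on it for every point $x$ on it. For a quadric $Q$ with external centre $o$ and linearly independent $a,b\in Q$, $(Q,o;a,b)$ is called a planar sector. Its sector coefficient $\chi(Q,o;a,b)$ is the unique $\beta_0\in\mathbb{R}$ with $\{(x,y)\in\mathbb{R}^2\mid xa+yb\in Q\}=\{(x,y)\in\mathbb{R}^2\mid x^2+\beta_0xy+y^2=1\}$, and its sector region is $\{xa+yb\mid x,y\ge0,\ x^2+\beta_0xy+y^2\le1\}$. For pairwise linearly independent $a,b,c\in\mathbb{R}^2$ there is exactly one quadric $Q$ with external centre $o$ and $a,b,c\in Q$; with this $Q$ put $\delta(a,b;c):=\chi(Q,o;a,b)/2$. If $\delta=\delta(a,b;c)>-1$, the angle between $a$ and $b$ with respect to $c$ is $$\angle(a,b;c):=\begin{cases}\arccos\delta & \text{if }\delta\le1,\\ \operatorname{arcosh}\delta & \text{if }\delta>1;\end{cases}$$ it is not defined if $\delta(a,b;c)\le-1$. *)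

theory Defs
  imports "HOL-Analysis.Analysis"
begin

definition quadratic_form :: "(real^2 \<Rightarrow> real) \<Rightarrow> bool" where
  "quadratic_form q \<longleftrightarrow> (\<exists>B. bilinear B \<and> (\<forall>x. q x = B x x))"

definition quadric :: "(real^2) set \<Rightarrow> bool" where
  "quadric Q \<longleftrightarrow> Q \<noteq> {} \<and>
     (\<exists>q l \<gamma>0. quadratic_form q \<and> linear l \<and> Q = {x. q x + l x + \<gamma>0 = (0::real)})"

definition external_centre :: "real^2 \<Rightarrow> (real^2) set \<Rightarrow> bool" where
  "external_centre p Q \<longleftrightarrow> p \<notin> Q \<and> (\<forall>x\<in>Q. 2 *\<^sub>R p - x \<in> Q)"

text \<open>The conjunct \<open>a \<noteq> b\<close> is needed because \<open>{a, b}\<close> collapses to a singleton when \<open>a = b\<close>.\<close>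

definition lin_indep2 :: "real^2 \<Rightarrow> real^2 \<Rightarrow> bool" where
  "lin_indep2 a b \<longleftrightarrow> a \<noteq> b \<and> independent {a, b}"

text \<open>Planar sectors, their coefficients and their regions are always taken with respect to the
  origin as external centre.\<close>

definition planar_sector :: "(real^2) set \<Rightarrow> real^2 \<Rightarrow> real^2 \<Rightarrow> bool" where
  "planar_sector Q a b \<longleftrightarrow>
     quadric Q \<and> external_centre 0 Q \<and> a \<in> Q \<and> b \<in> Q \<and> lin_indep2 a b"

definition sector_coeff :: "(real^2) set \<Rightarrow> real^2 \<Rightarrow> real^2 \<Rightarrow> real" where
  "sector_coeff Q a b =
     (THE \<beta>0. {(x, y). x *\<^sub>R a + y *\<^sub>R b \<in> Q} = {(x, y). x\<^sup>2 + \<beta>0 * x * y + y\<^sup>2 = 1})"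

definition sector_region :: "(real^2) set \<Rightarrow> real^2 \<Rightarrow> real^2 \<Rightarrow> (real^2) set" where
  "sector_region Q a b =
     {x *\<^sub>R a + y *\<^sub>R b | x y. x \<ge> 0 \<and> y \<ge> 0 \<and> x\<^sup>2 + sector_coeff Q a b * x * y + y\<^sup>2 \<le> 1}"

definition quadric_through :: "real^2 \<Rightarrow> real^2 \<Rightarrow> real^2 \<Rightarrow> (real^2) set" where
  "quadric_through a b c =
     (THE Q. quadric Q \<and> external_centre 0 Q \<and> a \<in> Q \<and> b \<in> Q \<and> c \<in> Q)"

definition sector_delta :: "real^2 \<Rightarrow> real^2 \<Rightarrow> real^2 \<Rightarrow> real" where
  "sector_delta a b c = sector_coeff (quadric_through a b c) a b / 2"

definition angle_defined :: "real^2 \<Rightarrow> real^2 \<Rightarrow> real^2 \<Rightarrow> bool" where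
  "angle_defined a b c \<longleftrightarrow> sector_delta a b c > -1"

definition angle :: "real^2 \<Rightarrow> real^2 \<Rightarrow> real^2 \<Rightarrow> real" where
  "angle a b c =
     (if angle_defined a b c
      then (if sector_delta a b c \<le> 1 then arccos (sector_delta a b c)
            else arcosh (sector_delta a b c))
      else undefined)"

text \<open>The two definite descriptions above are well defined.\<close>

lemma lin_indep2_det:
  assumes "lin_indep2 a b"
  shows "a$1 * b$2 - a$2 * b$1 \<noteq> 0"
proof
  assume D: "a$1 * b$2 - a$2 * b$1 = 0"
  have "a \<notin> span {b}" "b \<noteq> 0"
    using assms unfolding lin_indep2_def
    by (auto simp: independent_insert split: if_splits)
  moreover have "a = (a$1 / b$1) *\<^sub>R b" if "b$1 \<noteq> 0"
    using that D by (auto simp: vec_eq_iff forall_2 field_simps)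
  moreover have "a = (a$2 / b$2) *\<^sub>R b" if "b$2 \<noteq> 0"
    using that D by (auto simp: vec_eq_iff forall_2 field_simps)
  moreover have "b$1 \<noteq> 0 \<or> b$2 \<noteq> 0"
    using \<open>b \<noteq> 0\<close> by (auto simp: vec_eq_iff forall_2)
  ultimately show False
    by (metis rangeI span_singleton)
qed

lemma lin_indep2_coords:
  fixes a b p :: "real^2"
  defines "D \<equiv> a$1 * b$2 - a$2 * b$1"
  assumes "lin_indep2 a b"
  shows "p = x *\<^sub>R a + y *\<^sub>R b \<longleftrightarrow>
    x = (p$1 * b$2 - p$2 * b$1) / D \<and> y = (a$1 * p$2 - a$2 * p$1) / D"
proof
  have D: "D \<noteq> 0" using lin_indep2_det[OF assms(2)] by (simp add: D_def)
  {
    assume p: "p = x *\<^sub>R a + y *\<^sub>R b"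
    show "x = (p$1 * b$2 - p$2 * b$1) / D \<and> y = (a$1 * p$2 - a$2 * p$1) / D"
      using D unfolding p D_def by (auto simp: field_simps)
  next
    assume p: "x = (p$1 * b$2 - p$2 * b$1) / D \<and> y = (a$1 * p$2 - a$2 * p$1) / D"
    have "D * p$i = D * (x * a$i + y * b$i)" for i
      using D exhaust_2[of i] by (auto simp: p distrib_left) (auto simp: D_def algebra_simps)
    then show "p = x *\<^sub>R a + y *\<^sub>R b"
      using D by (auto simp: vec_eq_iff)
  }
qed

lemma sector_coeff_unique:
  fixes \<beta> \<beta>' :: real
  assumes "{(x, y). x\<^sup>2 + \<beta> * x * y + y\<^sup>2 = 1} = {(x, y). x\<^sup>2 + \<beta>' * x * y + y\<^sup>2 = 1}"
  shows "\<beta> = \<beta>'"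
proof -
  define t where "t = 1 / (1 + \<bar>\<beta>\<bar>)"
  have t: "t > 0" by (simp add: t_def add_pos_nonneg)
  have "\<bar>\<beta> * t\<bar> < 1" by (simp add: t_def abs_mult)
  then have "1 + \<beta> * t + t\<^sup>2 > 0" using zero_le_power2[of t] by linarith
  then obtain s where s: "s\<^sup>2 * (1 + \<beta> * t + t\<^sup>2) = 1" "s \<noteq> 0"
    by (intro that[of "1 / sqrt (1 + \<beta> * t + t\<^sup>2)"]) (auto simp: power_divide)
  have "(s, s * t) \<in> {(x, y). x\<^sup>2 + \<beta> * x * y + y\<^sup>2 = 1}"
    using s by (simp add: algebra_simps power2_eq_square)
  then have "(s, s * t) \<in> {(x, y). x\<^sup>2 + \<beta>' * x * y + y\<^sup>2 = 1}"
    by (simp only: assms)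
  then have "s\<^sup>2 * (1 + \<beta>' * t + t\<^sup>2) = 1"
    by (simp add: algebra_simps power2_eq_square)
  with s have "s\<^sup>2 * (1 + \<beta> * t + t\<^sup>2) = s\<^sup>2 * (1 + \<beta>' * t + t\<^sup>2)" by simp
  then have "1 + \<beta> * t + t\<^sup>2 = 1 + \<beta>' * t + t\<^sup>2"
    using s(2) by (simp only: mult_cancel_left) simp
  with t show ?thesis by simp
qed

lemma sector_coeff_exists:
  assumes "planar_sector Q a b"
  shows "\<exists>\<beta>0. {(x, y). x *\<^sub>R a + y *\<^sub>R b \<in> Q} = {(x, y). x\<^sup>2 + \<beta>0 * x * y + y\<^sup>2 = 1}"
proof -
  obtain B l g where B: "bilinear B" and l: "linear l"
    and Q: "Q = {x. B x x + l x + g = (0::real)}"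
  proof -
    obtain q l g where q: "quadratic_form q" and l: "linear l"
      and Q: "Q = {x. q x + l x + g = (0::real)}"
      using assms unfolding planar_sector_def quadric_def by blast
    from q obtain B where B: "bilinear B" "\<And>x. q x = B x x"
      unfolding quadratic_form_def by blast
    show thesis using that[OF B(1) l] Q B(2) by simp
  qed
  have ab: "a \<in> Q" "b \<in> Q" "- a \<in> Q" "- b \<in> Q" and "0 \<notin> Q"
    using assms unfolding planar_sector_def external_centre_def by auto
  have neg: "B (- x) (- x) = B x x" for x
    using B by (simp add: bilinear_lneg bilinear_rneg)
  have l0: "l a = 0" "l b = 0"
    using ab unfolding Q by (auto simp: neg linear_neg[OF l])
  have g: "g \<noteq> 0"
    using \<open>0 \<notin> Q\<close> unfolding Q by (auto simp: bilinear_lzero[OF B] linear_0[OF l])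
  have Ba: "B a a = - g" "B b b = - g"
    using ab(1,2) l0 unfolding Q by simp_all
  define \<beta> where "\<beta> = - (B a b + B b a) / g"
  have \<beta>: "B a b + B b a = - (g * \<beta>)" using g by (simp add: \<beta>_def)
  have "x *\<^sub>R a + y *\<^sub>R b \<in> Q \<longleftrightarrow> x\<^sup>2 + \<beta> * x * y + y\<^sup>2 = 1" for x y
  proof -
    have "B (x *\<^sub>R a + y *\<^sub>R b) (x *\<^sub>R a + y *\<^sub>R b) =
        x\<^sup>2 * B a a + x * y * (B a b + B b a) + y\<^sup>2 * B b b"
      by (simp add: bilinear_ladd[OF B] bilinear_radd[OF B] bilinear_lmul[OF B]
          bilinear_rmul[OF B] algebra_simps power2_eq_square)
    moreover have "l (x *\<^sub>R a + y *\<^sub>R b) = 0"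
      by (simp add: linear_add[OF l] linear_scale[OF l] l0)
    ultimately have "x *\<^sub>R a + y *\<^sub>R b \<in> Q \<longleftrightarrow> g * (x\<^sup>2 + \<beta> * x * y + y\<^sup>2) = g * 1"
      unfolding Q \<beta> Ba by (auto simp: algebra_simps)
    then show ?thesis using g by (simp only: mult_cancel_left) simp
  qed
  then show ?thesis by (intro exI[of _ \<beta>]) simp
qed

lemma sector_coeff_ex1:
  assumes "planar_sector Q a b"
  shows "\<exists>!\<beta>0. {(x, y). x *\<^sub>R a + y *\<^sub>R b \<in> Q} = {(x, y). x\<^sup>2 + \<beta>0 * x * y + y\<^sup>2 = 1}"
proof -
  obtain \<beta> where
    \<beta>: "{(x, y). x *\<^sub>R a + y *\<^sub>R b \<in> Q} = {(x, y). x\<^sup>2 + \<beta> * x * y + y\<^sup>2 = 1}"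
    using sector_coeff_exists[OF assms] by blast
  show ?thesis
  proof (rule ex1I)
    show "{(x, y). x *\<^sub>R a + y *\<^sub>R b \<in> Q} = {(x, y). x\<^sup>2 + \<beta> * x * y + y\<^sup>2 = 1}" by (fact \<beta>)
    show "s = \<beta>" if "{(x, y). x *\<^sub>R a + y *\<^sub>R b \<in> Q} = {(x, y). x\<^sup>2 + s * x * y + y\<^sup>2 = 1}" for s
      using sector_coeff_unique[OF that[symmetric, unfolded \<beta>]] by simp
  qed
qed

lemma quadric_through_ex1:
  assumes ab: "lin_indep2 a b" and ac: "lin_indep2 a c" and bc: "lin_indep2 b c"
  shows "\<exists>!Q. quadric Q \<and> external_centre 0 Q \<and> a \<in> Q \<and> b \<in> Q \<and> c \<in> Q"
proof -
  define D where "D = a$1 * b$2 - a$2 * b$1"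
  define u v where "u p = (p$1 * b$2 - p$2 * b$1) / D"
    and "v p = (a$1 * p$2 - a$2 * p$1) / D" for p :: "real^2"
  have D: "D \<noteq> 0" using lin_indep2_det[OF ab] by (simp add: D_def)
  have uv: "p = u p *\<^sub>R a + v p *\<^sub>R b" for p
    using lin_indep2_coords[OF ab, of p "u p" "v p"] by (simp add: u_def v_def D_def)
  have c0: "u c \<noteq> 0" "v c \<noteq> 0"
    using D lin_indep2_det[OF ac] lin_indep2_det[OF bc] by (auto simp: u_def v_def mult.commute)
  have lin: "linear u" "linear v"
    by (auto intro!: linearI simp: u_def v_def algebra_simps add_divide_distrib diff_divide_distrib)
  have uvab: "u a = 1" "v a = 0" "u b = 0" "v b = 1"
    using D by (auto simp: u_def v_def D_def algebra_simps)
  define \<beta> where "\<beta> = (1 - (u c)\<^sup>2 - (v c)\<^sup>2) / (u c * v c)"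
  have \<beta>c: "(u c)\<^sup>2 + s * u c * v c + (v c)\<^sup>2 = 1 \<longleftrightarrow> s = \<beta>" for s
    using c0 by (auto simp: \<beta>_def field_simps)
  let ?R = "{p. (u p)\<^sup>2 + \<beta> * u p * v p + (v p)\<^sup>2 = 1}"
  let ?P = "\<lambda>Q. quadric Q \<and> external_centre 0 Q \<and> a \<in> Q \<and> b \<in> Q \<and> c \<in> Q"
  have "?P ?R"
  proof (intro conjI)
    show "a \<in> ?R" "b \<in> ?R" "c \<in> ?R" using \<beta>c[of \<beta>] by (auto simp: uvab)
    show "external_centre 0 ?R"
      using lin by (auto simp: external_centre_def linear_0 linear_neg)
    show "quadric ?R" unfolding quadric_def
    proof (intro conjI exI)
      show "?R \<noteq> {}" using \<open>a \<in> ?R\<close> by blast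
      show "linear (\<lambda>x::real^2. 0::real)" by (auto intro: linearI)
      show "quadratic_form (\<lambda>p. (u p)\<^sup>2 + \<beta> * u p * v p + (v p)\<^sup>2)"
        unfolding quadratic_form_def
      proof (intro exI conjI allI)
        let ?B = "\<lambda>p r. u p * u r + \<beta> * u p * v r + v p * v r"
        show "bilinear ?B" unfolding bilinear_def
          by (auto intro!: linearI simp: linear_add[OF lin(1)] linear_add[OF lin(2)]
              linear_scale[OF lin(1)] linear_scale[OF lin(2)] algebra_simps)
        show "(u p)\<^sup>2 + \<beta> * u p * v p + (v p)\<^sup>2 = ?B p p" for p
          by (simp add: power2_eq_square)
      qed
      show "?R = {x. (u x)\<^sup>2 + \<beta> * u x * v x + (v x)\<^sup>2 + 0 + - 1 = 0}" by auto
    qed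
  qed
  moreover have "Q = ?R" if Q: "?P Q" for Q
  proof -
    have "planar_sector Q a b" using Q ab by (simp add: planar_sector_def)
    then obtain s where
      "{(x, y). x *\<^sub>R a + y *\<^sub>R b \<in> Q} = {(x, y). x\<^sup>2 + s * x * y + y\<^sup>2 = 1}"
      using sector_coeff_exists by blast
    then have *: "x *\<^sub>R a + y *\<^sub>R b \<in> Q \<longleftrightarrow> x\<^sup>2 + s * x * y + y\<^sup>2 = 1" for x y
      by (auto simp: set_eq_iff)
    have **: "p \<in> Q \<longleftrightarrow> (u p)\<^sup>2 + s * u p * v p + (v p)\<^sup>2 = 1" for p
      using *[of "u p" "v p"] uv[of p] by simp
    have "s = \<beta>" using **[of c] Q \<beta>c by blast
    then show ?thesis using ** by blast
  qed
  ultimately show ?thesis by blast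
qed

end

theory Submission
  imports Defs "HOL-Real_Asymp.Real_Asymp"
begin

text \<open>
  Write \<open>B\<close> for the symmetric bilinear form of \<open>T\<close>. Since \<open>a\<close>, \<open>b\<close> lie on the quadric,
  \<open>B a a = B b b = 1\<close>, so in the coordinates with respect to \<open>a, b\<close> the quadric has the equation
  \<open>x\<^sup>2 + 2 s x y + y\<^sup>2 = 1\<close> with \<open>s = B a b\<close>. The quadric through \<open>a, b, c\<close> centred at the
  origin being unique, \<open>sector_delta\<close> of any two of the three points is the value of \<open>B\<close> on them
  (lemma \<open>sector_delta_eq\<close>). Everything becomes a statement about the number \<open>s\<close>.

  The Gram determinant gives \<open>1 - s\<^sup>2 = D\<^sup>2 det T\<close>, where \<open>D\<close> is the determinant of \<open>a, b\<close>, up to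
  sign twice the area of the triangle (\<open>sector_discriminant\<close>); this is the formula for the triangle.

  For the sector, integrating over the slopes \<open>t = y / x\<close> shows that the region
  \<open>x\<^sup>2 + 2 s x y + y\<^sup>2 \<le> 1\<close> of the first quadrant has area
  \<open>\<integral> dt / (2 (1 + 2 s t + t\<^sup>2))\<close> over \<open>t \<ge> 0\<close> (\<open>emeasure_unit_sector\<close>). For
  \<open>\<bar>s\<bar> < 1\<close> and for \<open>s > 1\<close> this elementary integral is the angle divided by \<open>2 sqrt \<bar>1 - s\<^sup>2\<bar>\<close>. Passing to the region in the plane multiplies the area by \<open>\<bar>D\<bar>\<close>, and the
  discriminant identity turns the quotient into the angle divided by \<open>2 sqrt \<bar>det T\<bar>\<close>. The region
  is bounded exactly for \<open>s > -1\<close>: on the quadrant the form is bounded below by a positive multiple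
  of \<open>x\<^sup>2 + y\<^sup>2\<close> if it is positive on the diagonal \<open>x = y\<close>, and otherwise the diagonal ray stays
  inside.

  If \<open>c = x a + y b\<close>, then \<open>B a c = x + s y\<close> and \<open>B c b = s x + y\<close>, and additivity of the angles is the
  addition theorem of the cosine or of the hyperbolic cosine (\<open>angle_of_delta_add\<close>). If instead
  \<open>-c = x a + y b\<close>, the angles of \<open>c\<close> are the supplements of those of \<open>-c\<close>, which gives the sum
  \<open>2 \<pi>\<close>.
\<close>

section \<open>Areas in the first quadrant\<close>

lemma lborel_vec2_measurable:
  "(\<lambda>p::real\<times>real. vector [fst p, snd p] :: real^2) \<in> borel_measurable borel"
proof -
  have "linear (\<lambda>p::real\<times>real. vector [fst p, snd p] :: real^2)"
    by (rule linearI) (auto simp: vec_eq_iff forall_2)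
  then show ?thesis
    by (intro borel_measurable_continuous_onI linear_continuous_on) (simp add: linear_linear)
qed

text \<open>Tonelli's theorem is stated for products, the determinant formula for the measure of a
  linear image for \<open>real^2\<close>; identifying the two Lebesgue measures lets both be used.\<close>

lemma lborel_vec2:
  "distr (lborel :: (real \<times> real) measure) borel (\<lambda>p. vector [fst p, snd p] :: real^2) = lborel"
proof (rule lborel_eqI[symmetric])
  fix l u :: "real^2" assume lu: "\<And>b. b \<in> Basis \<Longrightarrow> l \<bullet> b \<le> u \<bullet> b"
  have le: "l $ 1 \<le> u $ 1" "l $ 2 \<le> u $ 2"
    using lu[of "axis 1 1"] lu[of "axis 2 1"] by (auto simp: inner_axis axis_in_Basis_iff)
  have "(\<lambda>p::real\<times>real. vector [fst p, snd p] :: real^2) -` box l u =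
      {l$1<..<u$1} \<times> {l$2<..<u$2}"
    by (auto simp: mem_box_cart forall_2)
  then have "emeasure (distr (lborel :: (real \<times> real) measure) borel
      (\<lambda>p. vector [fst p, snd p] :: real^2)) (box l u) =
      emeasure (lborel \<Otimes>\<^sub>M lborel) ({l$1<..<u$1} \<times> {l$2<..<u$2})"
    using lborel_vec2_measurable by (simp add: emeasure_distr lborel_prod)
  also have "\<dots> = ennreal (u$1 - l$1) * ennreal (u$2 - l$2)"
    using le by (subst lborel.emeasure_pair_measure_Times) auto
  also have "\<dots> = ennreal (\<Prod>b\<in>Basis. (u - l) \<bullet> b)"
  proof -
    have B: "(Basis :: (real^2) set) = {axis 1 1, axis 2 1}"
      by (auto simp: Basis_vec_def UNIV_2)
    show ?thesis using le unfolding B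
      by (simp add: axis_eq_axis inner_axis ennreal_mult)
  qed
  finally show "emeasure (distr (lborel :: (real \<times> real) measure) borel
      (\<lambda>p. vector [fst p, snd p] :: real^2)) (box l u) = ennreal (\<Prod>b\<in>Basis. (u - l) \<bullet> b)" .
qed simp

text \<open>The substitution \<open>y = t x\<close>, with Jacobian \<open>x\<close>, turns a region in the first quadrant into
  the union over the slopes \<open>t \<ge> 0\<close> of the segments \<open>0 \<le> x \<le> 1 / sqrt (q t)\<close>, each of which contributes
  \<open>\<integral> x dx = 1 / (2 q t)\<close>. Performed inside Tonelli's theorem it is a one-dimensional scaling for
  each fixed \<open>x\<close>, followed by an exchange of the two integrals.\<close>

lemma emeasure_quadrant_by_slopes:
  fixes R :: "(real \<times> real) set" and q :: "real \<Rightarrow> real"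
  assumes R: "R \<in> sets borel"
    and R_eq: "R = {(x, y). 0 \<le> x \<and> 0 \<le> y \<and> P x y}"
    and P: "\<And>x t. 0 < x \<Longrightarrow> 0 \<le> t \<Longrightarrow> P x (t * x) \<longleftrightarrow> x\<^sup>2 * q t \<le> 1"
    and q: "\<And>t. 0 \<le> t \<Longrightarrow> 0 < q t"
    and q_meas: "q \<in> borel_measurable borel"
    and F: "\<And>t. 0 \<le> t \<Longrightarrow> (F has_real_derivative 1 / (2 * q t)) (at t)"
    and lim: "(F \<longlongrightarrow> L) at_top"
  shows "emeasure lborel R = ennreal (L - F 0)"
proof -
  note [measurable] = q_meas
  have R_prod [measurable]: "R \<in> sets (lborel \<Otimes>\<^sub>M lborel)"
    using R by (metis lborel_prod sets_lborel)
  define G where "G x t = ennreal x * indicator {0 .. 1 / sqrt (q t)} x * indicator {0 ..} t"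
    for x t :: real
  have [measurable]: "(\<lambda>(x, t). G x t) \<in> borel_measurable (lborel \<Otimes>\<^sub>M lborel)"
    unfolding G_def by (auto simp: indicator_def)
  \<comment> \<open>Only the null set \<open>x = 0\<close>, where the slope is meaningless, is left out.\<close>
  have slice: "(\<integral>\<^sup>+y. indicator R (x, y) \<partial>lborel) = (\<integral>\<^sup>+t. G x t \<partial>lborel)" if "x \<noteq> 0" for x
  proof (cases "x > 0")
    case True
    have "(\<integral>\<^sup>+y. indicator R (x, y) \<partial>lborel) =
        ennreal x * (\<integral>\<^sup>+t. indicator R (x, 0 + x * t) \<partial>lborel)"
      using True by (subst nn_integral_real_affine[of _ x 0]) auto
    also have "\<dots> = (\<integral>\<^sup>+t. ennreal x * indicator R (x, 0 + x * t) \<partial>lborel)"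
      by (subst nn_integral_cmult) auto
    also have "\<dots> = (\<integral>\<^sup>+t. G x t \<partial>lborel)"
    proof (rule nn_integral_cong)
      fix t :: real
      have "(x, x * t) \<in> R \<longleftrightarrow> 0 \<le> t \<and> x \<le> 1 / sqrt (q t)"
      proof (cases "0 \<le> t")
        case t: True
        have "(x, x * t) \<in> R \<longleftrightarrow> (x * sqrt (q t))\<^sup>2 \<le> 1\<^sup>2"
          using True t P[OF True t] q[OF t] by (simp add: R_eq power_mult_distrib mult.commute)
        also have "\<dots> \<longleftrightarrow> x * sqrt (q t) \<le> 1"
          using True q[OF t] by (intro power2_le_iff_abs_le[THEN trans]) auto
        also have "\<dots> \<longleftrightarrow> x \<le> 1 / sqrt (q t)"
          using q[OF t] by (simp add: field_simps)
        finally show ?thesis using t by simp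
      next
        case False then show ?thesis using True by (auto simp: R_eq zero_le_mult_iff)
      qed
      then show "ennreal x * indicator R (x, 0 + x * t) = G x t"
        using True by (auto simp: G_def indicator_def)
    qed
    finally show ?thesis .
  next
    case False
    then have "x < 0" using that by simp
    then show ?thesis by (simp add: R_eq G_def)
  qed
  have "emeasure lborel R = (\<integral>\<^sup>+x. \<integral>\<^sup>+y. indicator R (x, y) \<partial>lborel \<partial>lborel)"
    unfolding lborel_prod[symmetric] by (rule lborel.emeasure_pair_measure[OF R_prod])
  also have "\<dots> = (\<integral>\<^sup>+x. \<integral>\<^sup>+t. G x t \<partial>lborel \<partial>lborel)"
    using slice by (intro nn_integral_cong_AE) (use AE_lborel_singleton[of 0] in eventually_elim, auto)
  also have "\<dots> = (\<integral>\<^sup>+t. \<integral>\<^sup>+x. G x t \<partial>lborel \<partial>lborel)"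
    by (rule lborel_pair.Fubini'[symmetric]) simp
  also have "\<dots> = (\<integral>\<^sup>+t. ennreal (1 / (2 * q t)) * indicator {0 ..} t \<partial>lborel)"
  proof (rule nn_integral_cong)
    fix t :: real
    show "(\<integral>\<^sup>+x. G x t \<partial>lborel) = ennreal (1 / (2 * q t)) * indicator {0 ..} t"
    proof (cases "0 \<le> t")
      case True
      have "(\<integral>\<^sup>+x. ennreal x * indicator {0 .. 1 / sqrt (q t)} x \<partial>lborel) =
          ennreal ((1 / sqrt (q t))\<^sup>2 / 2 - 0\<^sup>2 / 2)"
        using q[OF True]
        by (intro nn_integral_FTC_Icc) (auto intro!: derivative_eq_intros)
      then show ?thesis using q[OF True] True by (simp add: G_def power_divide)
    qed (simp add: G_def)
  qed
  also have "\<dots> = ennreal (L - F 0)"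
    using q F lim by (intro nn_integral_FTC_atLeast) (auto intro: less_imp_le)
  finally show ?thesis .
qed

section \<open>The sector of a form with unit diagonal\<close>

text \<open>At \<open>t = 1\<close> the form has the value \<open>2 + 2 s\<close>, so \<open>s > -1\<close> is exactly what makes it positive
  on the whole quadrant, even when it is indefinite on the plane.\<close>

lemma quadrant_form_pos:
  fixes s t :: real
  assumes "-1 < s" "0 \<le> t"
  shows "0 < 1 + 2 * s * t + t\<^sup>2"
proof -
  have "1 + 2 * s * t + t\<^sup>2 = (1 - t)\<^sup>2 + 2 * (1 + s) * t"
    by (simp add: power2_eq_square algebra_simps)
  moreover have "0 \<le> 2 * (1 + s) * t" using assms by simp
  moreover have "0 < 2 * (1 + s) * t" if "t = 1" using assms that by simp
  ultimately show ?thesis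
    using zero_less_power2[of "1 - t"] by (cases "t = 1") (simp, linarith)
qed

text \<open>The sector region in the coordinates with respect to \<open>a\<close> and \<open>b\<close>. The parameter is half the
  sector coefficient, because this is the value of the bilinear form at \<open>a, b\<close>: the cosine or
  hyperbolic cosine of their angle, where that is defined.\<close>

definition unit_sector :: "real \<Rightarrow> (real \<times> real) set" where
  "unit_sector s = {(x, y). 0 \<le> x \<and> 0 \<le> y \<and> x\<^sup>2 + 2 * s * x * y + y\<^sup>2 \<le> 1}"

lemma closed_unit_sector: "closed (unit_sector s)"
  unfolding unit_sector_def case_prod_beta
  by (intro closed_Collect_conj closed_Collect_le continuous_intros)

lemma emeasure_unit_sector:
  assumes s: "-1 < s"
    and F: "\<And>t. 0 \<le> t \<Longrightarrow>
      (F has_real_derivative 1 / (2 * (1 + 2 * s * t + t\<^sup>2))) (at t)"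
    and lim: "(F \<longlongrightarrow> L) at_top"
  shows "emeasure lborel (unit_sector s) = ennreal (L - F 0)"
proof (rule emeasure_quadrant_by_slopes[where F = F and q = "\<lambda>t. 1 + 2 * s * t + t\<^sup>2",
      OF _ unit_sector_def _ _ _ F lim])
  show "unit_sector s \<in> sets borel" using closed_unit_sector by simp
  show "x\<^sup>2 + 2 * s * x * (t * x) + (t * x)\<^sup>2 \<le> 1 \<longleftrightarrow> x\<^sup>2 * (1 + 2 * s * t + t\<^sup>2) \<le> 1"
    for x t :: real by (simp add: power2_eq_square algebra_simps)
qed (use s quadrant_form_pos in auto)

text \<open>With \<open>w\<^sup>2 = 1 - s\<^sup>2\<close> the form is \<open>1 + 2 s t + t\<^sup>2 = w\<^sup>2 + (t + s)\<^sup>2\<close>, whose reciprocal integrates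
  to an arctangent.\<close>

lemma emeasure_unit_sector_elliptic:
  assumes s: "\<bar>s\<bar> < 1"
  shows "emeasure lborel (unit_sector s) = ennreal (arccos s / (2 * sqrt (1 - s\<^sup>2)))"
proof -
  define w where "w = sqrt (1 - s\<^sup>2)"
  have w: "w > 0" "w\<^sup>2 = 1 - s\<^sup>2" using abs_square_less_1[of s] s by (auto simp: w_def)
  define F where "F t = arctan ((t + s) / w) / (2 * w)" for t
  have "emeasure lborel (unit_sector s) = ennreal (pi / 2 / (2 * w) - F 0)"
  proof (rule emeasure_unit_sector)
    show "-1 < s" using s by simp
    show "(F has_real_derivative 1 / (2 * (1 + 2 * s * t + t\<^sup>2))) (at t)" if "0 \<le> t" for t
    proof -
      have "1 + 2 * s * t + t\<^sup>2 = w\<^sup>2 * (1 + ((t + s) / w)\<^sup>2)"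
      proof -
        have "w\<^sup>2 * ((t + s) / w)\<^sup>2 = (t + s)\<^sup>2" using w(1) by (simp add: power_divide)
        then show ?thesis by (simp add: distrib_left w(2)) (simp add: power2_eq_square algebra_simps)
      qed
      then have "1 / (2 * (1 + 2 * s * t + t\<^sup>2)) = (1 / w) * inverse (1 + ((t + s) / w)\<^sup>2) / (2 * w)"
        using w(1) by (simp add: divide_simps power2_eq_square)
      then show ?thesis unfolding F_def
        using w(1) by (auto intro!: derivative_eq_intros simp: mult.commute)
    qed
    have "filterlim (\<lambda>t. (t + s) / w) at_top at_top" using w(1) by real_asymp
    from filterlim_compose[OF tendsto_arctan_at_top this]
    show "(F \<longlongrightarrow> pi / 2 / (2 * w)) at_top"
      unfolding F_def using w(1) by (intro tendsto_divide) auto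
  qed
  also have "arctan (s / w) = pi / 2 - arccos s"
    using s by (simp add: arccos_arctan w_def)
  then have "pi / 2 / (2 * w) - F 0 = arccos s / (2 * w)"
    by (simp add: F_def diff_divide_distrib)
  finally show ?thesis by (simp add: w_def)
qed

text \<open>Here \<open>1 + 2 s t + t\<^sup>2\<close> splits into the factors \<open>t + s - w\<close> and \<open>t + s + w\<close> with
  \<open>w\<^sup>2 = s\<^sup>2 - 1\<close>, and partial fractions give a difference of logarithms.\<close>

lemma emeasure_unit_sector_hyperbolic:
  assumes s: "1 < s"
  shows "emeasure lborel (unit_sector s) = ennreal (arcosh s / (2 * sqrt (s\<^sup>2 - 1)))"
proof -
  define w where "w = sqrt (s\<^sup>2 - 1)"
  have w: "w > 0" "w\<^sup>2 = s\<^sup>2 - 1" using one_less_power[OF s, of 2] by (auto simp: w_def)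
  have ws: "w < s" using s w(2) by (intro power2_less_imp_less[of w s]) auto
  define F where "F t = (ln (t + s - w) - ln (t + s + w)) / (4 * w)" for t
  have "emeasure lborel (unit_sector s) = ennreal (0 - F 0)"
  proof (rule emeasure_unit_sector)
    show "-1 < s" using s by simp
    show "(F has_real_derivative 1 / (2 * (1 + 2 * s * t + t\<^sup>2))) (at t)" if "0 \<le> t" for t
    proof -
      have "1 + 2 * s * t + t\<^sup>2 = (t + s - w) * (t + s + w)"
        using w(2) by (simp add: algebra_simps power2_eq_square)
      moreover have "t + s - w > 0" "t + s + w > 0" using that ws w(1) by auto
      moreover from this have
        "1 / (2 * ((t + s - w) * (t + s + w))) = (1 / (t + s - w) - 1 / (t + s + w)) / (4 * w)"
        using w(1) by (simp add: divide_simps)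
      moreover have "(F has_real_derivative (1 / (t + s - w) - 1 / (t + s + w)) / (4 * w)) (at t)"
        unfolding F_def using \<open>t + s - w > 0\<close> \<open>t + s + w > 0\<close>
        by (intro DERIV_cdivide DERIV_diff) (auto intro!: derivative_eq_intros)
      ultimately show ?thesis by simp
    qed
    have "((\<lambda>t. (t + s - w) / (t + s + w)) \<longlongrightarrow> 1) at_top" by real_asymp
    then have "((\<lambda>t. ln ((t + s - w) / (t + s + w)) / (4 * w)) \<longlongrightarrow> ln 1 / (4 * w)) at_top"
      using w(1) by (intro tendsto_intros) auto
    moreover have "\<forall>\<^sub>F t in at_top. ln ((t + s - w) / (t + s + w)) / (4 * w) = F t"
      using eventually_ge_at_top[of 0] by eventually_elim (use ws w(1) in \<open>simp add: F_def ln_div\<close>)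
    ultimately show "(F \<longlongrightarrow> 0) at_top"
      using Lim_transform_eventually by fastforce
  qed
  also have "0 - F 0 = arcosh s / (2 * w)"
  proof -
    \<comment> \<open>By this identity the difference of logarithms at \<open>0\<close> is \<open>- 2 ln (s + w) = - 2 arcosh s\<close>.\<close>
    have "(s - w) * (s + w) = 1" using w(2) by (simp add: algebra_simps power2_eq_square)
    then have "s - w = inverse (s + w)" using w(1) s by (simp add: field_simps)
    then have "ln (s - w) = - ln (s + w)" using w(1) s by (simp add: ln_inverse)
    then show ?thesis using s w(1) by (simp add: F_def arcosh_real_def w_def[symmetric] field_simps)
  qed
  finally show ?thesis by (simp add: w_def)
qed

text \<open>For \<open>s \<le> -1\<close> the diagonal ray stays in the sector. For \<open>s > -1\<close> the form dominates
  \<open>min 1 (1 + s)\<close> times the squared Euclidean norm on the quadrant.\<close>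

lemma bounded_unit_sector_iff: "bounded (unit_sector s) \<longleftrightarrow> -1 < s"
proof
  assume s: "-1 < s"
  define m where "m = min 1 (1 + s)"
  have m: "0 < m" using s by (simp add: m_def)
  have "norm p \<le> sqrt (1 / m)" if "p \<in> unit_sector s" for p
  proof -
    obtain x y where p: "p = (x, y)" "0 \<le> x" "0 \<le> y" "x\<^sup>2 + 2 * s * x * y + y\<^sup>2 \<le> 1"
      using \<open>p \<in> unit_sector s\<close> by (auto simp: unit_sector_def)
    have "m * (x\<^sup>2 + y\<^sup>2) \<le> x\<^sup>2 + 2 * s * x * y + y\<^sup>2"
    proof (cases "0 \<le> s")
      case True then show ?thesis using p by (simp add: m_def)
    next
      case False
      have "s * (x - y)\<^sup>2 \<le> 0" using False by (simp add: mult_nonpos_nonneg)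
      then show ?thesis using False by (simp add: m_def power2_eq_square algebra_simps)
    qed
    with p m have "x\<^sup>2 + y\<^sup>2 \<le> 1 / m" by (simp add: field_simps)
    then show ?thesis by (simp add: p norm_Pair)
  qed
  then show "bounded (unit_sector s)" unfolding bounded_iff by blast
next
  assume "bounded (unit_sector s)"
  then obtain M where M: "\<And>p. p \<in> unit_sector s \<Longrightarrow> norm p \<le> M"
    unfolding bounded_iff by blast
  show "-1 < s"
  proof (rule ccontr)
    assume "\<not> -1 < s"
    define t where "t = \<bar>M\<bar> + 1"
    have "0 \<le> t" by (simp add: t_def)
    have "2 * (1 + s) * t\<^sup>2 \<le> 0"
      using \<open>\<not> -1 < s\<close> by (simp add: mult_nonpos_nonneg)
    then have "(t, t) \<in> unit_sector s"
      using \<open>0 \<le> t\<close> by (simp add: unit_sector_def power2_eq_square algebra_simps)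
    then have "norm (t, t) \<le> M" by (rule M)
    moreover have "norm t \<le> norm (t, t)" using norm_fst_le[of t t] by simp
    ultimately show False by (simp add: t_def)
  qed
qed

lemma linear_combination_image:
  fixes a b :: "real^2"
  shows "linear (\<lambda>v::real^2. v$1 *\<^sub>R a + v$2 *\<^sub>R b)"
    and "det (matrix (\<lambda>v::real^2. v$1 *\<^sub>R a + v$2 *\<^sub>R b)) = a$1 * b$2 - a$2 * b$1"
  by (rule linearI) (auto simp: algebra_simps matrix_def det_2 axis_def)

lemma measure_linear_combinations:
  fixes a b :: "real^2" and R :: "(real \<times> real) set"
  assumes R: "R \<in> sets borel" "emeasure lborel R < \<infinity>"
  shows "measure lebesgue ((\<lambda>(x, y). x *\<^sub>R a + y *\<^sub>R b) ` R) =
    \<bar>a$1 * b$2 - a$2 * b$1\<bar> * measure lborel R"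
proof -
  let ?f = "\<lambda>v::real^2. v$1 *\<^sub>R a + v$2 *\<^sub>R b"
  define S :: "(real^2) set" where "S = {v. (v$1, v$2) \<in> R}"
  have S_borel: "S \<in> sets borel"
  proof -
    have "(\<lambda>v::real^2. (v$1, v$2)) \<in> borel_measurable borel"
      by (intro borel_measurable_continuous_onI continuous_intros)
    from measurable_sets[OF this R(1)] show ?thesis by (simp add: S_def vimage_def)
  qed
  have "emeasure lborel S = emeasure (distr (lborel :: (real \<times> real) measure) borel
      (\<lambda>p. vector [fst p, snd p] :: real^2)) S"
    by (simp add: lborel_vec2)
  also have "\<dots> = emeasure lborel ((\<lambda>p. vector [fst p, snd p] :: real^2) -` S)"
    using S_borel lborel_vec2_measurable by (simp add: emeasure_distr)
  also have "(\<lambda>p. vector [fst p, snd p] :: real^2) -` S = R"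
    by (auto simp: S_def)
  finally have eS: "emeasure lborel S = emeasure lborel R" .
  have "S \<in> lmeasurable"
    using S_borel R(2) eS by (auto simp: fmeasurable_def)
  moreover have "(\<lambda>(x, y). x *\<^sub>R a + y *\<^sub>R b) ` R = ?f ` S"
  proof -
    have "(\<lambda>v::real^2. (v$1, v$2)) ` S = R"
    proof (intro equalityI subsetI)
      fix p assume "p \<in> R"
      then show "p \<in> (\<lambda>v::real^2. (v$1, v$2)) ` S"
        by (intro image_eqI[of _ _ "vector [fst p, snd p]"]) (auto simp: S_def)
    qed (auto simp: S_def)
    then have "(\<lambda>(x, y). x *\<^sub>R a + y *\<^sub>R b) ` R =
        (\<lambda>(x, y). x *\<^sub>R a + y *\<^sub>R b) ` (\<lambda>v::real^2. (v$1, v$2)) ` S" by simp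
    then show ?thesis by (simp add: image_image)
  qed
  ultimately show ?thesis
    using S_borel eS measure_linear_image[OF linear_combination_image(1), of S a b]
    by (simp add: linear_combination_image(2) measure_def)
qed

lemma measure_sector_image:
  fixes a b :: "real^2" and s :: real
  defines "A \<equiv> measure lebesgue ((\<lambda>(x, y). x *\<^sub>R a + y *\<^sub>R b) ` unit_sector s)"
    and "D \<equiv> \<bar>a$1 * b$2 - a$2 * b$1\<bar>"
  shows "\<bar>s\<bar> < 1 \<Longrightarrow> A = D * (arccos s / (2 * sqrt (1 - s\<^sup>2)))"
    and "1 < s \<Longrightarrow> A = D * (arcosh s / (2 * sqrt (s\<^sup>2 - 1)))"
proof -
  have meas: "unit_sector s \<in> sets borel" using closed_unit_sector by simp
  show "A = D * (arccos s / (2 * sqrt (1 - s\<^sup>2)))" if "\<bar>s\<bar> < 1"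
  proof -
    have "0 \<le> arccos s" "0 \<le> 1 - s\<^sup>2"
      using that abs_square_less_1[of s] by (auto simp: arccos_lbound)
    then show ?thesis unfolding A_def D_def
      using emeasure_unit_sector_elliptic[OF that]
      by (subst measure_linear_combinations[OF meas]) (simp_all add: measure_def)
  qed
  show "A = D * (arcosh s / (2 * sqrt (s\<^sup>2 - 1)))" if "1 < s"
  proof -
    have "0 \<le> arcosh s" "0 \<le> s\<^sup>2 - 1"
      using that one_less_power[OF that, of 2] by auto
    then show ?thesis unfolding A_def D_def
      using emeasure_unit_sector_hyperbolic[OF that]
      by (subst measure_linear_combinations[OF meas]) (simp_all add: measure_def)
  qed
qed

text \<open>Both the coordinate map and its inverse (Cramer's rule) are linear.\<close>

lemma bounded_linear_combinations_iff:
  fixes a b :: "real^2" and R :: "(real \<times> real) set"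
  assumes "lin_indep2 a b"
  shows "bounded ((\<lambda>(x, y). x *\<^sub>R a + y *\<^sub>R b) ` R) \<longleftrightarrow> bounded R"
proof
  let ?f = "\<lambda>(x::real, y::real). x *\<^sub>R a + y *\<^sub>R b"
  let ?g = "\<lambda>p::real^2. ((p$1 * b$2 - p$2 * b$1) / (a$1 * b$2 - a$2 * b$1),
      (a$1 * p$2 - a$2 * p$1) / (a$1 * b$2 - a$2 * b$1))"
  have f: "linear ?f" by (rule linearI) (auto simp: algebra_simps)
  have g: "linear ?g"
    by (rule linearI) (auto simp: algebra_simps add_divide_distrib diff_divide_distrib)
  show "bounded (?f ` R)" if "bounded R"
    using that linear_conv_bounded_linear[THEN iffD1, OF f] by (rule bounded_linear_image)
  show "bounded R" if "bounded (?f ` R)"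
  proof -
    have "?g (?f p) = p" for p
      using lin_indep2_coords[OF assms, of "?f p" "fst p" "snd p"]
      by (simp add: case_prod_beta prod_eq_iff)
    then have "?g ` ?f ` R = R" by (simp only: image_image image_ident)
    moreover have "bounded (?g ` ?f ` R)"
      using that linear_conv_bounded_linear[THEN iffD1, OF g] by (rule bounded_linear_image)
    ultimately show ?thesis by simp
  qed
qed

section \<open>Addition of the angles on a normalised quadric\<close>

text \<open>If \<open>s = cos \<theta>\<close>, then \<open>x + s y\<close> and \<open>s x + y\<close> are the cosines of the angles that
  \<open>c = x a + y b\<close> makes with \<open>a\<close> and \<open>b\<close>; their sines are \<open>y sin \<theta>\<close> and \<open>x sin \<theta>\<close>. The addition
  formula then reproduces \<open>s\<close> times the form.\<close>

lemma arccos_add_of_unit_form: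
  fixes s x y :: real
  assumes s: "\<bar>s\<bar> < 1" and xy: "0 < x" "0 < y" and form: "x\<^sup>2 + 2 * s * x * y + y\<^sup>2 = 1"
  shows "\<bar>x + s * y\<bar> < 1" "\<bar>s * x + y\<bar> < 1"
    and "arccos (x + s * y) + arccos (s * x + y) = arccos s"
proof -
  define w where "w = sqrt (1 - s\<^sup>2)"
  have w: "w > 0" "w\<^sup>2 = 1 - s\<^sup>2" using abs_square_less_1[of s] s by (auto simp: w_def)
  define u v where "u = x + s * y" and "v = s * x + y"
  have "u\<^sup>2 + (y * w)\<^sup>2 = x\<^sup>2 + 2 * s * x * y + y\<^sup>2" "v\<^sup>2 + (x * w)\<^sup>2 = x\<^sup>2 + 2 * s * x * y + y\<^sup>2"
    unfolding u_def v_def power_mult_distrib w(2)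
    by (simp_all add: power2_eq_square algebra_simps)
  then have u: "1 - u\<^sup>2 = (y * w)\<^sup>2" and v: "1 - v\<^sup>2 = (x * w)\<^sup>2"
    unfolding form by linarith+
  have "0 < (y * w)\<^sup>2" "0 < (x * w)\<^sup>2" using w xy by simp_all
  then have "u\<^sup>2 < 1" "v\<^sup>2 < 1" using u v by linarith+
  then have uv1: "\<bar>u\<bar> < 1" "\<bar>v\<bar> < 1" by (simp_all add: abs_square_less_1)
  then show "\<bar>x + s * y\<bar> < 1" "\<bar>s * x + y\<bar> < 1" by (simp_all add: u_def v_def)
  have sin_u: "sin (arccos u) = y * w" and sin_v: "sin (arccos v) = x * w"
    using uv1 u v w(1) xy by (simp_all add: sin_arccos_abs)
  have cos_u: "cos (arccos u) = u" and cos_v: "cos (arccos v) = v" using uv1 by simp_all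
  have "cos (arccos u + arccos v) = u * v - (y * x) * w\<^sup>2"
    by (simp add: cos_add cos_u cos_v sin_u sin_v power2_eq_square)
  also have "\<dots> = s * (x\<^sup>2 + 2 * s * x * y + y\<^sup>2)"
    unfolding w(2) u_def v_def by (simp add: power2_eq_square algebra_simps)
  finally have cos: "cos (arccos u + arccos v) = s" by (simp add: form)
  \<comment> \<open>Equal cosines identify the angles only within \<open>[0, \<pi>]\<close>; a positive sine places the sum there.\<close>
  have "sin (arccos u + arccos v) = w * (x\<^sup>2 + 2 * s * x * y + y\<^sup>2)"
    unfolding sin_add cos_u cos_v sin_u sin_v
    by (simp add: u_def v_def power2_eq_square algebra_simps)
  then have sin: "0 < sin (arccos u + arccos v)" using w(1) by (simp add: form)
  have bounds: "0 \<le> arccos u" "0 \<le> arccos v" "arccos u < pi" "arccos v < pi"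
    using uv1 arccos_lt_bounded[of u] arccos_lt_bounded[of v] by (auto simp: abs_less_iff)
  have "arccos u + arccos v \<le> pi"
  proof (rule ccontr)
    assume "\<not> arccos u + arccos v \<le> pi"
    then have "sin (arccos u + arccos v) \<le> 0"
      using bounds by (intro sin_le_zero) auto
    with sin show False by simp
  qed
  then have "arccos (cos (arccos u + arccos v)) = arccos u + arccos v"
    using bounds by (intro arccos_cos) auto
  then show "arccos (x + s * y) + arccos (s * x + y) = arccos s"
    unfolding cos by (simp add: u_def v_def)
qed

text \<open>The same computation with hyperbolic functions, where \<open>arcosh\<close> inverts \<open>cosh\<close> on all
  nonnegative sums, so that no range has to be controlled.\<close>

lemma arcosh_add_of_unit_form:
  fixes s x y :: real
  assumes s: "1 < s" and xy: "0 < x" "0 < y" and form: "x\<^sup>2 + 2 * s * x * y + y\<^sup>2 = 1"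
  shows "1 < x + s * y" "1 < s * x + y"
    and "arcosh (x + s * y) + arcosh (s * x + y) = arcosh s"
proof -
  define w where "w = sqrt (s\<^sup>2 - 1)"
  have w: "w > 0" "w\<^sup>2 = s\<^sup>2 - 1" using one_less_power[OF s, of 2] by (auto simp: w_def)
  define u v where "u = x + s * y" and "v = s * x + y"
  have "u\<^sup>2 - (y * w)\<^sup>2 = x\<^sup>2 + 2 * s * x * y + y\<^sup>2" "v\<^sup>2 - (x * w)\<^sup>2 = x\<^sup>2 + 2 * s * x * y + y\<^sup>2"
    unfolding u_def v_def power_mult_distrib w(2)
    by (simp_all add: power2_eq_square algebra_simps)
  then have u: "u\<^sup>2 - 1 = (y * w)\<^sup>2" and v: "v\<^sup>2 - 1 = (x * w)\<^sup>2"
    unfolding form by linarith+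
  have "0 < (y * w)\<^sup>2" "0 < (x * w)\<^sup>2" using w xy by simp_all
  then have "1\<^sup>2 < u\<^sup>2" "1\<^sup>2 < v\<^sup>2" using u v by (simp_all only: one_power2)
  moreover have "0 < u" "0 < v" using s xy by (simp_all add: u_def v_def add_pos_pos)
  ultimately have uv1: "1 < u" "1 < v" by (auto intro: power_less_imp_less_base)
  then show "1 < x + s * y" "1 < s * x + y" by (simp_all add: u_def v_def)
  have "cosh (arcosh u + arcosh v) = u * v + (y * x) * w\<^sup>2"
    using uv1 xy w(1)
    by (simp add: cosh_add sinh_arcosh_real u v) (simp add: power2_eq_square)
  also have "\<dots> = s * (x\<^sup>2 + 2 * s * x * y + y\<^sup>2)"
    unfolding w(2) u_def v_def by (simp add: power2_eq_square algebra_simps)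
  finally have "cosh (arcosh u + arcosh v) = s" by (simp add: form)
  moreover have "arcosh (cosh (arcosh u + arcosh v)) = arcosh u + arcosh v"
    using uv1 by (intro arcosh_cosh_real add_nonneg_nonneg arcosh_nonneg_real) auto
  ultimately show "arcosh (x + s * y) + arcosh (s * x + y) = arcosh s"
    by (simp add: u_def v_def)
qed

text \<open>The angle as a total function of \<open>\<delta>\<close>; it represents \<open>angle\<close> for \<open>\<delta> > -1\<close>.\<close>

definition angle_of_delta :: "real \<Rightarrow> real" where
  "angle_of_delta \<delta> = (if \<delta> \<le> 1 then arccos \<delta> else arcosh \<delta>)"

text \<open>The parabolic value \<open>s = 1\<close>, where the quadric is a pair of parallel lines, falls between the
  two addition formulas: there \<open>x + y = 1\<close>, and all three angles vanish.\<close>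

lemma angle_of_delta_add:
  fixes s x y :: real
  assumes s: "-1 < s" and xy: "0 < x" "0 < y" and form: "x\<^sup>2 + 2 * s * x * y + y\<^sup>2 = 1"
  shows "angle_of_delta (x + s * y) + angle_of_delta (s * x + y) = angle_of_delta s"
proof (cases s "1 :: real" rule: linorder_cases)
  case less
  then have "\<bar>s\<bar> < 1" using s by simp
  from arccos_add_of_unit_form[OF this xy form] less show ?thesis
    by (simp add: angle_of_delta_def abs_less_iff)
next
  case equal
  then have "(x + y)\<^sup>2 = 1" using form by (simp add: power2_eq_square algebra_simps)
  then have "x + y = 1" using xy by (simp add: power2_eq_1_iff)
  then show ?thesis using equal by (simp add: angle_of_delta_def)
next
  case greater
  from arcosh_add_of_unit_form[OF this xy form] greater show ?thesis
    by (simp add: angle_of_delta_def)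
qed

text \<open>Replacing \<open>c\<close> by \<open>-c\<close> turns the two partial angles into their supplements.\<close>

lemma arccos_sum_2pi_of_unit_form:
  fixes s x y :: real
  assumes "\<bar>s\<bar> < 1" "0 < x" "0 < y" "x\<^sup>2 + 2 * s * x * y + y\<^sup>2 = 1"
  shows "\<bar>- (x + s * y)\<bar> < 1" "\<bar>- (s * x + y)\<bar> < 1"
    and "arccos s + arccos (- (s * x + y)) + arccos (- (x + s * y)) = 2 * pi"
proof -
  note * = arccos_add_of_unit_form[OF assms]
  show "\<bar>- (x + s * y)\<bar> < 1" "\<bar>- (s * x + y)\<bar> < 1" using *(1,2) by (simp_all del: minus_add_distrib)
  have "arccos (- (s * x + y)) = pi - arccos (s * x + y)"
    "arccos (- (x + s * y)) = pi - arccos (x + s * y)"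
    using *(1,2) by (simp_all add: arccos_minus del: minus_add_distrib)
  with *(3) show "arccos s + arccos (- (s * x + y)) + arccos (- (x + s * y)) = 2 * pi" by simp
qed

section \<open>Sectors of the quadric of a symmetric matrix\<close>

lemma lin_indep2_sym: "lin_indep2 a b \<Longrightarrow> lin_indep2 b a"
  by (simp add: lin_indep2_def insert_commute eq_commute)

definition matrix_form :: "real^2^2 \<Rightarrow> real^2 \<Rightarrow> real^2 \<Rightarrow> real" where
  "matrix_form T v w = v \<bullet> (T *v w)"

lemma matrix_form_coords:
  assumes "transpose T = T"
  shows "matrix_form T v w =
    T$1$1 * v$1 * w$1 + T$1$2 * (v$1 * w$2 + v$2 * w$1) + T$2$2 * v$2 * w$2"
    and "det T = T$1$1 * T$2$2 - (T$1$2)\<^sup>2"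
proof -
  have T: "T$2$1 = T$1$2" using arg_cong[OF assms, of "\<lambda>M. M$1$2"] by (simp add: transpose_def)
  show "matrix_form T v w =
    T$1$1 * v$1 * w$1 + T$1$2 * (v$1 * w$2 + v$2 * w$1) + T$2$2 * v$2 * w$2"
    by (simp add: matrix_form_def inner_vec_def sum_2 matrix_vector_mult_def T algebra_simps)
  show "det T = T$1$1 * T$2$2 - (T$1$2)\<^sup>2"
    by (simp add: det_2 T power2_eq_square)
qed

text \<open>The Gram matrix of \<open>a, b\<close> is \<open>M\<^sup>t T M\<close>, where \<open>M\<close> has the columns \<open>a, b\<close>; this is its
  determinant.\<close>

lemma matrix_form_gram:
  assumes "transpose T = T"
  shows "matrix_form T a a * matrix_form T b b - (matrix_form T a b)\<^sup>2 =
    (a$1 * b$2 - a$2 * b$1)\<^sup>2 * det T"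
  unfolding matrix_form_coords[OF assms] by (simp add: power2_eq_square algebra_simps)

lemma matrix_form_combination:
  assumes "transpose T = T"
  shows "matrix_form T (x *\<^sub>R a + y *\<^sub>R b) w = x * matrix_form T a w + y * matrix_form T b w"
    and "matrix_form T w (x *\<^sub>R a + y *\<^sub>R b) = x * matrix_form T w a + y * matrix_form T w b"
    and "matrix_form T v w = matrix_form T w v"
    and "matrix_form T (x *\<^sub>R a + y *\<^sub>R b) (x *\<^sub>R a + y *\<^sub>R b) =
      x\<^sup>2 * matrix_form T a a + 2 * matrix_form T a b * x * y + y\<^sup>2 * matrix_form T b b"
  unfolding matrix_form_coords[OF assms] by (simp_all add: algebra_simps power2_eq_square)

locale matrix_quadric =
  fixes T :: "real^2^2" and Q :: "(real^2) set"
  assumes T_sym: "transpose T = T" and Q_eq: "Q = {v. matrix_form T v v = 1}"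
begin

lemma planar_sector_points:
  assumes "a \<in> Q" "b \<in> Q" "lin_indep2 a b"
  shows "planar_sector Q a b"
proof -
  have "quadratic_form (\<lambda>v. matrix_form T v v)" unfolding quadratic_form_def
  proof (intro exI conjI allI)
    show "bilinear (matrix_form T)" unfolding bilinear_def
      by (auto intro!: linearI simp: matrix_form_coords[OF T_sym] algebra_simps)
  qed simp
  moreover have "Q = {v. matrix_form T v v + 0 + - 1 = 0}" by (auto simp: Q_eq)
  moreover have "linear (\<lambda>v::real^2. 0::real)" by (auto intro: linearI)
  ultimately have "\<exists>q l \<gamma>0. quadratic_form q \<and> linear l \<and> Q = {v. q v + l v + \<gamma>0 = 0}"
    by (intro exI conjI)
  then have "quadric Q" using assms(1) unfolding quadric_def by auto
  moreover have "external_centre 0 Q"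
    by (simp add: external_centre_def Q_eq matrix_form_coords[OF T_sym])
  ultimately show ?thesis using assms by (simp add: planar_sector_def)
qed

lemma sector_coeff_eq:
  assumes "a \<in> Q" "b \<in> Q" "lin_indep2 a b"
  shows "sector_coeff Q a b = 2 * matrix_form T a b"
  unfolding sector_coeff_def
proof (rule the1_equality[OF sector_coeff_ex1[OF planar_sector_points[OF assms]]])
  show "{(x, y). x *\<^sub>R a + y *\<^sub>R b \<in> Q} =
      {(x, y). x\<^sup>2 + 2 * matrix_form T a b * x * y + y\<^sup>2 = 1}"
    using assms(1,2) by (auto simp: Q_eq matrix_form_combination(4)[OF T_sym])
qed

lemma sector_delta_eq:
  assumes "a \<in> Q" "b \<in> Q" "c \<in> Q" "lin_indep2 a b" "lin_indep2 a c" "lin_indep2 b c"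
  shows "sector_delta a b c = matrix_form T a b"
proof -
  have "quadric_through a b c = Q" unfolding quadric_through_def
    using planar_sector_points[OF assms(1,2,4)] assms
    by (intro the1_equality quadric_through_ex1) (auto simp: planar_sector_def)
  then show ?thesis using assms by (simp add: sector_delta_def sector_coeff_eq)
qed

lemma sector_region_eq:
  assumes "a \<in> Q" "b \<in> Q" "lin_indep2 a b"
  shows "sector_region Q a b =
    (\<lambda>(x, y). x *\<^sub>R a + y *\<^sub>R b) ` unit_sector (matrix_form T a b)"
  unfolding sector_region_def unit_sector_def sector_coeff_eq[OF assms] by auto

text \<open>This links the two normalisations of area: the discriminant of the form in the coordinates
  given by \<open>a, b\<close> is that of the form of \<open>T\<close> times the squared area of the parallelogram spanned
  by \<open>a, b\<close>.\<close>

lemma sector_discriminant: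
  assumes "a \<in> Q" "b \<in> Q"
  shows "1 - (matrix_form T a b)\<^sup>2 = (a$1 * b$2 - a$2 * b$1)\<^sup>2 * det T"
  using matrix_form_gram[OF T_sym, of a b] assms by (simp add: Q_eq)

text \<open>The area scaling factor \<open>D\<close> of the coordinate map cancels against the factor \<open>D\<close> by which
  the square roots of the two discriminants differ.\<close>

lemma measure_sector_region:
  fixes a b :: "real^2"
  defines "\<delta> \<equiv> matrix_form T a b"
  assumes ab: "a \<in> Q" "b \<in> Q" "lin_indep2 a b" and \<delta>: "\<bar>\<delta>\<bar> < 1 \<or> 1 < \<delta>"
  shows "measure lebesgue (sector_region Q a b) = angle_of_delta \<delta> / (2 * sqrt \<bar>det T\<bar>)"
proof -
  define D where "D = \<bar>a$1 * b$2 - a$2 * b$1\<bar>"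
  have D: "D > 0" using lin_indep2_det[OF ab(3)] by (simp add: D_def)
  have disc: "sqrt \<bar>1 - \<delta>\<^sup>2\<bar> = D * sqrt \<bar>det T\<bar>"
    using sector_discriminant[OF ab(1,2)]
    by (simp add: \<delta>_def D_def abs_mult real_sqrt_mult real_sqrt_abs)
  have "measure lebesgue (sector_region Q a b) = D * (angle_of_delta \<delta> / (2 * sqrt \<bar>1 - \<delta>\<^sup>2\<bar>))"
  proof (cases "1 < \<delta>")
    case True
    then show ?thesis
      using measure_sector_image(2)[OF True, of a b] one_less_power[OF True, of 2]
      by (simp add: sector_region_eq[OF ab] \<delta>_def[symmetric] D_def angle_of_delta_def)
  next
    case False
    then have "\<bar>\<delta>\<bar> < 1" using \<delta> by simp
    then show ?thesis
      using False measure_sector_image(1)[of \<delta> a b] abs_square_less_1[of \<delta>]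
      by (simp add: sector_region_eq[OF ab] \<delta>_def[symmetric] D_def angle_of_delta_def)
  qed
  then show ?thesis unfolding disc using D by simp
qed

end

lemma measure_triangle:
  fixes a b :: "real^2"
  shows "measure lebesgue (convex hull {0, a, b}) = \<bar>a$1 * b$2 - a$2 * b$1\<bar> / 2"
proof -
  have "compact (convex hull {0, a, b})" by (intro finite_imp_compact_convex_hull) simp
  then have "measure lebesgue (convex hull {0, a, b}) = measure lborel (convex hull {0, a, b})"
    by (simp add: borel_compact)
  also have "\<dots> = \<bar>b$1 * a$2 - a$1 * b$2\<bar> / 2" by (simp add: content_triangle)
  also have "\<bar>b$1 * a$2 - a$1 * b$2\<bar> = \<bar>a$1 * b$2 - a$2 * b$1\<bar>"
    by (simp add: abs_minus_commute mult.commute)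
  finally show ?thesis .
qed

section \<open>The area and angle formulas\<close>

theorem corollary4p2:
  fixes T :: "real^2^2" and Q :: "(real^2) set" and a b c :: "real^2"
  assumes T_sym: "transpose T = T"
    and Q_eq: "Q = {v. v \<bullet> (T *v v) = 1}"
    and abc_in_Q: "a \<in> Q" "b \<in> Q" "c \<in> Q"
    and indep: "lin_indep2 a b" "lin_indep2 a c" "lin_indep2 b c"
  shows
    "(sector_delta a b c)\<^sup>2 = 1 - 4 * (measure lebesgue (convex hull {0, a, b}))\<^sup>2 * det T
     \<and>
     (\<bar>sector_delta a b c\<bar> < 1 \<or> sector_delta a b c > 1 \<longrightarrow>
        measure lebesgue (sector_region Q a b) = angle a b c / (2 * sqrt \<bar>det T\<bar>))
     \<and>
     (\<forall>(\<alpha>::real) (\<beta>::real) (\<gamma>::real) (\<kappa>::real) (l::real) (\<mu>::real) (\<nu>::real) (\<delta>::real).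
        (\<forall>x y. (vector [x, y] :: real^2) \<bullet> (T *v vector [x, y])
                  = \<alpha> * x\<^sup>2 + \<beta> * x * y + \<gamma> * y\<^sup>2) \<and>
        a = vector [\<kappa>, l] \<and> b = vector [\<mu>, \<nu>] \<and>
        \<delta> = \<alpha> * \<kappa> * \<mu> + \<beta> * (\<kappa> * \<nu> + l * \<mu>) / 2 + \<gamma> * l * \<nu>
        \<longrightarrow>
        (bounded (sector_region Q a b) \<longleftrightarrow> \<delta> > -1) \<and>
        (\<bar>\<delta>\<bar> < 1 \<longrightarrow> measure lebesgue (sector_region Q a b)
                        = arccos \<delta> / sqrt (4 * \<alpha> * \<gamma> - \<beta>\<^sup>2)) \<and>
        (\<delta> > 1 \<longrightarrow> measure lebesgue (sector_region Q a b)
                        = arcosh \<delta> / sqrt (\<beta>\<^sup>2 - 4 * \<alpha> * \<gamma>)))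
     \<and>
     ((\<exists>x y. x > 0 \<and> y > 0 \<and> c = x *\<^sub>R a + y *\<^sub>R b) \<and>
        angle_defined a c b \<and> angle_defined c b a \<and> angle_defined a b c \<longrightarrow>
        angle a c b + angle c b a = angle a b c)
     \<and>
     (\<bar>sector_delta a b c\<bar> < 1 \<and>
        (\<exists>x y. x > 0 \<and> y > 0 \<and> - c = x *\<^sub>R a + y *\<^sub>R b) \<longrightarrow>
        angle_defined a b c \<and> angle_defined b c a \<and> angle_defined c a b \<and>
        angle a b c + angle b c a + angle c a b = 2 * pi)"
proof -
  interpret matrix_quadric T Q
    by unfold_locales (simp_all add: T_sym Q_eq matrix_form_def)
  let ?B = "matrix_form T"
  note ab = abc_in_Q(1,2) indep(1)
  note indep' = indep[THEN lin_indep2_sym]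
  have delta_ab: "sector_delta a b c = ?B a b"
    and delta_ac: "sector_delta a c b = ?B a c" and delta_cb: "sector_delta c b a = ?B c b"
    and delta_bc: "sector_delta b c a = ?B b c" and delta_ca: "sector_delta c a b = ?B c a"
    using abc_in_Q indep indep' by (simp_all add: sector_delta_eq)
  have angle: "angle p q r = angle_of_delta (sector_delta p q r)" if "angle_defined p q r" for p q r
    using that by (simp add: angle_def angle_of_delta_def)
  have Ba: "?B a a = 1" and Bb: "?B b b = 1" and Bc: "?B c c = 1"
    using abc_in_Q by (simp_all add: matrix_quadric.Q_eq[OF matrix_quadric_axioms])
  note combo = matrix_form_combination[OF T_sym]

  show ?thesis
  proof (intro conjI allI impI)
    show "(sector_delta a b c)\<^sup>2 = 1 - 4 * (measure lebesgue (convex hull {0, a, b}))\<^sup>2 * det T"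
      using sector_discriminant[OF ab(1,2)]
      by (simp add: delta_ab measure_triangle power_divide)
  next
    assume case_ass: "\<bar>sector_delta a b c\<bar> < 1 \<or> sector_delta a b c > 1"
    then have "angle_defined a b c" by (auto simp: angle_defined_def)
    then show "measure lebesgue (sector_region Q a b) = angle a b c / (2 * sqrt \<bar>det T\<bar>)"
      using measure_sector_region[OF ab] case_ass by (simp add: angle delta_ab)
  next
    fix \<alpha> \<beta> \<gamma> \<kappa> l \<mu> \<nu> \<delta> :: real
    assume *: "(\<forall>x y. (vector [x, y] :: real^2) \<bullet> (T *v vector [x, y])
                  = \<alpha> * x\<^sup>2 + \<beta> * x * y + \<gamma> * y\<^sup>2) \<and>
        a = vector [\<kappa>, l] \<and> b = vector [\<mu>, \<nu>] \<and>
        \<delta> = \<alpha> * \<kappa> * \<mu> + \<beta> * (\<kappa> * \<nu> + l * \<mu>) / 2 + \<gamma> * l * \<nu>"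
    \<comment> \<open>Three test vectors recover the entries of \<open>T\<close> from the coefficients of its form.\<close>
    have form: "T$1$1 * x * x + T$1$2 * (x * y + y * x) + T$2$2 * y * y =
        \<alpha> * x\<^sup>2 + \<beta> * x * y + \<gamma> * y\<^sup>2" for x y
      using * by (simp add: matrix_form_def[symmetric] matrix_form_coords[OF T_sym])
    have T: "T$1$1 = \<alpha>" "T$2$2 = \<gamma>" "T$1$2 = \<beta> / 2"
      using form[of 1 0] form[of 0 1] form[of 1 1] by auto
    have \<delta>: "?B a b = \<delta>"
      using * by (simp add: matrix_form_coords(1)[OF T_sym] T)
    have det: "4 * \<alpha> * \<gamma> - \<beta>\<^sup>2 = 4 * det T"
      by (simp add: matrix_form_coords(2)[OF T_sym] T power_divide)
    have disc: "1 - \<delta>\<^sup>2 = (a$1 * b$2 - a$2 * b$1)\<^sup>2 * det T"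
      using sector_discriminant[OF ab(1,2)] by (simp add: \<delta>)
    show "bounded (sector_region Q a b) \<longleftrightarrow> \<delta> > -1"
      by (simp add: sector_region_eq[OF ab] bounded_linear_combinations_iff[OF ab(3)]
          bounded_unit_sector_iff \<delta>)
    show "measure lebesgue (sector_region Q a b) = arccos \<delta> / sqrt (4 * \<alpha> * \<gamma> - \<beta>\<^sup>2)"
      if "\<bar>\<delta>\<bar> < 1"
    proof -
      have "0 < 1 - \<delta>\<^sup>2" using that abs_square_less_1[of \<delta>] by simp
      then have "0 < det T" unfolding disc by (simp add: zero_less_mult_iff not_less)
      then show ?thesis
        using measure_sector_region[OF ab] that
        by (simp add: \<delta> det real_sqrt_mult angle_of_delta_def abs_less_iff)
    qed
    show "measure lebesgue (sector_region Q a b) = arcosh \<delta> / sqrt (\<beta>\<^sup>2 - 4 * \<alpha> * \<gamma>)"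
      if "\<delta> > 1"
    proof -
      have "1 - \<delta>\<^sup>2 < 0" using one_less_power[OF that, of 2] by simp
      then have "det T < 0" unfolding disc by (simp add: mult_less_0_iff not_less)
      then have "\<beta>\<^sup>2 - 4 * \<alpha> * \<gamma> = 4 * \<bar>det T\<bar>" using det by simp
      then have "sqrt (\<beta>\<^sup>2 - 4 * \<alpha> * \<gamma>) = 2 * sqrt \<bar>det T\<bar>"
        by (simp only: real_sqrt_mult real_sqrt_four)
      then show ?thesis
        using measure_sector_region[OF ab] that by (simp add: \<delta> angle_of_delta_def)
    qed
  next
    assume "(\<exists>x y. x > 0 \<and> y > 0 \<and> c = x *\<^sub>R a + y *\<^sub>R b) \<and>
        angle_defined a c b \<and> angle_defined c b a \<and> angle_defined a b c"
    then obtain x y where xy: "x > 0" "y > 0" and c: "c = x *\<^sub>R a + y *\<^sub>R b"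
      and def: "angle_defined a c b" "angle_defined c b a" "angle_defined a b c" by blast
    have form: "x\<^sup>2 + 2 * ?B a b * x * y + y\<^sup>2 = 1"
      using Bc unfolding c combo(4) Ba Bb by simp
    have "?B a c = x + ?B a b * y" "?B c b = ?B a b * x + y"
      unfolding c combo(1,2) Ba Bb by (simp_all add: mult.commute)
    then show "angle a c b + angle c b a = angle a b c"
      using angle_of_delta_add[OF _ xy form] def
      by (simp add: angle delta_ab delta_ac delta_cb angle_defined_def)
  next
    assume *: "\<bar>sector_delta a b c\<bar> < 1 \<and>
        (\<exists>x y. x > 0 \<and> y > 0 \<and> - c = x *\<^sub>R a + y *\<^sub>R b)"
    then obtain x y where xy: "x > 0" "y > 0" and "- c = x *\<^sub>R a + y *\<^sub>R b" by blast
    then have c: "c = (-x) *\<^sub>R a + (-y) *\<^sub>R b"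
      by (metis add.inverse_inverse minus_add_distrib scaleR_minus_left)
    have s: "\<bar>?B a b\<bar> < 1" using * by (simp add: delta_ab)
    have form: "x\<^sup>2 + 2 * ?B a b * x * y + y\<^sup>2 = 1"
      using Bc unfolding c combo(4) Ba Bb by simp
    have "?B c a = - (x + ?B a b * y)" "?B b c = - (?B a b * x + y)"
      unfolding c combo(1,2) Ba Bb combo(3)[of b a] by (simp_all add: mult.commute)
    note B = this
    note sum = arccos_sum_2pi_of_unit_form[OF s xy form]
    show def: "angle_defined a b c" "angle_defined b c a" "angle_defined c a b"
      using s sum(1,2) unfolding angle_defined_def delta_ab delta_bc delta_ca B
      by (simp_all only: abs_less_iff) linarith+
    have "angle_of_delta d = arccos d" if "\<bar>d\<bar> < 1" for d
      using that by (simp add: angle_of_delta_def abs_less_iff)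
    note arccos = this[OF s] this[OF sum(1)] this[OF sum(2)]
    show "angle a b c + angle b c a + angle c a b = 2 * pi"
      unfolding angle[OF def(1)] angle[OF def(2)] angle[OF def(3)]
        delta_ab delta_bc delta_ca B arccos by (rule sum(3))
  qed
qed

end
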